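(* Let $\mathbf{x},\mathbf{y},\mathbf{z}\in\mathbb{R}^n$, let $f:\mathbb{R}^n\to\mathbb{R}$ be a differentiable function, and let $M\in\mathbb{R}$ with $f(\mathbf{x})=M$. Suppose $\mathbf{z}=\mathbf{x}+\mathbf{y}$. If the cost function $c(\mathbf{z})=(f(\mathbf{z})-M)^2$ is convex, then gradient descent started at $\mathbf{z}^0=\mathbf{z}$ with iterations $\mathbf{z}^{k+1}=\mathbf{z}^k-\lambda\nabla c(\mathbf{z}^k)$, $k\in\{0,\dots,K\}$, converges to a point $\mathbf{z}^K$ such that $$\|\mathbf{x}-\mathbf{z}^K\|_2\le\|\mathbf{x}-\mathbf{z}\|_2$$ for any $\mathbf{z}$ and small enough step size $\lambda>0$.
   Context: The vectors are interpreted as vectorised weighted adjacency matrices of networks: $\mathbf{x}$ is a true network, $\mathbf{y}$ additive noise, and $\mathbf{z}$ the observed noisy network; $f$ is a graph metric whose value $M$ on the true network is known. *)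

theory Defs
  imports "HOL-Analysis.Analysis"
begin

(* Unspecified at points where g is not differentiable. *)
definition gradient :: "('a::real_inner \<Rightarrow> real) \<Rightarrow> 'a \<Rightarrow> 'a" where
  "gradient g w = (THE D. GDERIV g w :> D)"

lemma gradient_eqI:
  assumes "GDERIV g w :> D"
  shows "gradient g w = D"
  unfolding gradient_def
proof (rule the_equality)
  show "GDERIV g w :> D" by fact
next
  fix D' assume "GDERIV g w :> D'"
  then have "(\<lambda>h. inner h D') = (\<lambda>h. inner h D)"
    using assms unfolding gderiv_def by (rule has_derivative_unique)
  then have "inner (D' - D) D' = inner (D' - D) D" by meson
  then have "inner (D' - D) (D' - D) = 0" by (simp add: inner_diff_right)
  then show "D' = D" by simp
qed

lemma gderiv_gradient:
  fixes g :: "'a::euclidean_space \<Rightarrow> real"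
  assumes "g differentiable (at w)"
  shows "GDERIV g w :> gradient g w"
proof -
  obtain L where L: "(g has_derivative L) (at w)"
    using assms unfolding differentiable_def by blast
  interpret bounded_linear L using L by (rule has_derivative_bounded_linear)
  define D where "D = (\<Sum>b\<in>Basis. L b *\<^sub>R b)"
  have "L h = inner h D" for h
  proof -
    have "L h = L (\<Sum>b\<in>Basis. inner h b *\<^sub>R b)" by (simp add: euclidean_representation)
    also have "\<dots> = (\<Sum>b\<in>Basis. inner h b * L b)" by (simp add: sum scaleR)
    also have "\<dots> = inner h D"
      by (simp add: D_def inner_sum_right mult.commute)
    finally show ?thesis .
  qed
  then have "L = (\<lambda>h. inner h D)" by blast
  then have "GDERIV g w :> D" using L by (simp add: gderiv_def)
  then show ?thesis by (simp add: gradient_eqI)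
qed

definition cost :: "('a \<Rightarrow> real) \<Rightarrow> real \<Rightarrow> 'a \<Rightarrow> real" where
  "cost f M w = (f w - M)\<^sup>2"

primrec gradient_descent :: "('a::real_inner \<Rightarrow> real) \<Rightarrow> real \<Rightarrow> 'a \<Rightarrow> nat \<Rightarrow> 'a" where
  "gradient_descent g \<eta> w 0 = w"
| "gradient_descent g \<eta> w (Suc k) =
     gradient_descent g \<eta> w k - \<eta> *\<^sub>R gradient g (gradient_descent g \<eta> w k)"

end

theory Submission
  imports Defs
begin

text \<open>
  The gradient of the cost \<open>c\<close> need not be Lipschitz. But \<open>f\<close> is differentiable at \<open>x\<close>,
  so \<open>c h \<le> C * \<parallel>h - x\<parallel>\<^sup>2\<close> on a ball around the minimiser \<open>x\<close>. Comparing
  this with the tangent plane of \<open>c\<close> at \<open>w\<close>, evaluated at \<open>h = x + \<nabla>c(w) / (2 C)\<close>, gives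
  \<open>\<parallel>\<nabla>c(w)\<parallel>\<^sup>2 \<le> 4 C \<langle>\<nabla>c(w), w - x\<rangle>\<close>. For \<open>\<eta> < 1 / (4 C)\<close> each step
  therefore decreases \<open>\<parallel>w - x\<parallel>\<^sup>2\<close> by at least the squared step length. So the steps are square
  summable and \<open>c\<close> tends to \<open>0\<close> along the iterates. With respect to any other minimiser \<open>p\<close>,
  the squared distance grows in each step by at most the squared step length, hence converges;
  taking for \<open>p\<close> a cluster point of the iterates shows that the whole sequence converges.
\<close>

section \<open>Gradient inequalities for convex functions\<close>

text \<open>Restriction to the line through \<open>w\<close> and \<open>v\<close> reduces this to
  the one-variable tangent inequality.\<close>

lemma convex_on_imp_above_tangent_plane:
  fixes c :: "'a::real_inner \<Rightarrow> real"
  assumes "convex_on UNIV c" and "GDERIV c w :> D"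
  shows "c w + inner (v - w) D \<le> c v"
proof -
  define u where "u t = w + t *\<^sub>R (v - w)" for t :: real
  have "convex_on UNIV (\<lambda>t. c (u t))"
  proof (rule convex_onI)
    fix t a b :: real
    assume t: "0 < t" "t < 1"
    have "u ((1 - t) *\<^sub>R a + t *\<^sub>R b) = (1 - t) *\<^sub>R u a + t *\<^sub>R u b"
      by (simp add: u_def algebra_simps)
    then show "c (u ((1 - t) *\<^sub>R a + t *\<^sub>R b)) \<le> (1 - t) * c (u a) + t * c (u b)"
      using convex_onD[OF assms(1), of t "u a" "u b"] t by simp
  qed simp
  moreover have "((\<lambda>t. c (u t)) has_real_derivative inner (v - w) D) (at 0)"
  proof -
    have "(u has_derivative (\<lambda>t. t *\<^sub>R (v - w))) (at 0)"
      unfolding u_def by (auto intro!: derivative_eq_intros)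
    moreover have "(c has_derivative (\<lambda>h. inner h D)) (at (u 0))"
      using assms(2) by (simp add: gderiv_def u_def)
    ultimately have "((\<lambda>t. c (u t)) has_derivative (\<lambda>t. inner (t *\<^sub>R (v - w)) D)) (at 0)"
      by (rule has_derivative_compose)
    then show ?thesis
      by (simp add: has_field_derivative_def mult_commute_abs)
  qed
  ultimately have "inner (v - w) D * (1 - 0) \<le> c (u 1) - c (u 0)"
    by (intro convex_on_imp_above_tangent[where A = UNIV]) auto
  then show ?thesis
    by (simp add: u_def)
qed

text \<open>The factor \<open>1 / (2 * C)\<close> is the \<open>t\<close> that maximises
  \<open>(t - C * t\<^sup>2) * (norm D)\<^sup>2\<close>. The quadratic bound is asked for at this
  single point, since it will be available only on a ball.\<close>

lemma norm_sq_gradient_le_of_quadratic_bound: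
  fixes c :: "'a::real_inner \<Rightarrow> real"
  assumes convex: "convex_on UNIV c" and D: "GDERIV c w :> D"
    and nonneg: "0 \<le> c w" and C: "C > 0"
    and bound: "c (x + (1 / (2 * C)) *\<^sub>R D) \<le> C * (norm ((1 / (2 * C)) *\<^sub>R D))\<^sup>2"
  shows "(norm D)\<^sup>2 \<le> 4 * C * inner (w - x) D"
proof -
  have "c w + inner (x + (1 / (2 * C)) *\<^sub>R D - w) D \<le> c (x + (1 / (2 * C)) *\<^sub>R D)"
    by (rule convex_on_imp_above_tangent_plane[OF convex D])
  also have "\<dots> \<le> (norm D)\<^sup>2 / (4 * C)"
    using bound C by (simp add: power_mult_distrib power_divide power2_eq_square field_simps)
  finally have "(norm D)\<^sup>2 / (2 * C) - inner (w - x) D \<le> (norm D)\<^sup>2 / (4 * C)"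
    using nonneg by (simp add: inner_diff_left inner_add_left power2_norm_eq_inner)
  then show ?thesis
    using C by (simp add: field_simps)
qed

text \<open>A unit step along the gradient raises the tangent plane by \<open>norm (D w)\<close>,
  starting from \<open>c w\<close>, and stays in the larger ball.\<close>

lemma gradient_bounded_on_cball:
  fixes c :: "'a::euclidean_space \<Rightarrow> real"
  assumes convex: "convex_on UNIV c" and nonneg: "\<And>w. 0 \<le> c w"
    and D: "\<And>w. GDERIV c w :> D w"
    and B: "\<And>h. h \<in> cball x (R + 1) \<Longrightarrow> c h \<le> B"
    and w: "w \<in> cball x R"
  shows "norm (D w) \<le> B"
proof -
  have "norm (w + sgn (D w) - x) \<le> norm (w - x) + norm (sgn (D w))"
    by (metis add_diff_eq add.commute norm_triangle_ineq)
  also have "\<dots> \<le> R + 1"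
    using w by (auto simp: norm_sgn dist_norm norm_minus_commute)
  finally have "c (w + sgn (D w)) \<le> B"
    by (intro B) (simp add: dist_norm norm_minus_commute)
  \<comment> \<open>At a zero gradient \<open>sgn\<close> is \<open>0\<close>, and both sides
    vanish.\<close>
  moreover have "inner (sgn (D w)) (D w) = norm (D w)"
    by (cases "D w = 0") (simp_all add: sgn_div_norm dot_square_norm power2_eq_square)
  ultimately show ?thesis
    using convex_on_imp_above_tangent_plane[OF convex D, of w "w + sgn (D w)"] nonneg[of w] by simp
qed

section \<open>Quadratic upper bound for the cost around its minimiser\<close>

text \<open>Near \<open>x\<close>, differentiability makes \<open>f h - M\<close> at most linear in
  the distance, so its square is at most quadratic. At distance \<open>d\<close> or more,
  boundedness on the compact ball suffices.\<close>

lemma cost_quadratic_bound: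
  fixes f :: "'a::euclidean_space \<Rightarrow> real"
  assumes diff: "\<And>w. f differentiable (at w)" and "f x = M"
  obtains C where "\<And>h. h \<in> cball x r \<Longrightarrow> cost f M h \<le> C * (norm (h - x))\<^sup>2"
proof -
  obtain L where L: "(f has_derivative L) (at x)"
    using diff[of x] unfolding differentiable_def by blast
  interpret L: bounded_linear L
    using L by (rule has_derivative_bounded_linear)
  \<comment> \<open>The error tolerance is \<open>1\<close>; it becomes the \<open>1\<close> in
    \<open>1 + K\<close> below.\<close>
  obtain d where d: "d > 0"
    "\<And>h. norm (h - x) < d \<Longrightarrow> \<bar>f h - f x - L (h - x)\<bar> \<le> norm (h - x)"
    using L[unfolded has_derivative_at_alt] by (metis mult_1 real_norm_def zero_less_one)
  obtain K where K: "\<And>h. norm (L h) \<le> norm h * K"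
    using L.bounded by blast
  have "continuous_on (cball x r) (cost f M)"
    unfolding cost_def
    by (intro continuous_intros) (auto simp: continuous_on_eq_continuous_within
        intro!: differentiable_imp_continuous_within differentiable_at_withinI diff)
  then have "bounded (cost f M ` cball x r)"
    by (intro compact_imp_bounded compact_continuous_image compact_cball)
  then obtain B where B: "B > 0" "\<And>h. h \<in> cball x r \<Longrightarrow> \<bar>cost f M h\<bar> \<le> B"
    unfolding bounded_pos by auto
  show thesis
  proof (rule that)
    fix h assume h: "h \<in> cball x r"
    show "cost f M h \<le> max ((1 + K)\<^sup>2) (B / d\<^sup>2) * (norm (h - x))\<^sup>2"
    proof (cases "norm (h - x) < d")
      case True
      have "\<bar>f h - M\<bar> \<le> norm (h - x) * (1 + K)"
        using d(2)[OF True] K[of "h - x"] \<open>f x = M\<close> by (simp add: algebra_simps)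
      then have "cost f M h \<le> (norm (h - x) * (1 + K))\<^sup>2"
        unfolding cost_def by (metis abs_ge_zero power2_abs power_mono)
      also have "\<dots> \<le> max ((1 + K)\<^sup>2) (B / d\<^sup>2) * (norm (h - x))\<^sup>2"
        unfolding power_mult_distrib mult.commute[of "(norm (h - x))\<^sup>2"]
          by (intro mult_right_mono) auto
      finally show ?thesis .
    next
      case False
      then have "d\<^sup>2 \<le> (norm (h - x))\<^sup>2"
        using d(1) by (intro power_mono) auto
      have "cost f M h \<le> B / d\<^sup>2 * d\<^sup>2"
        using B(2)[OF h] d(1) by simp
      also have "\<dots> \<le> B / d\<^sup>2 * (norm (h - x))\<^sup>2"
        using \<open>d\<^sup>2 \<le> (norm (h - x))\<^sup>2\<close> B(1) by (intro mult_left_mono) auto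
      also have "\<dots> \<le> max ((1 + K)\<^sup>2) (B / d\<^sup>2) * (norm (h - x))\<^sup>2"
        by (intro mult_right_mono) auto
      finally show ?thesis .
    qed
  qed
qed

section \<open>Convergence of gradient descent\<close>

text \<open>Subtracting the partial sums of \<open>e\<close> leaves a decreasing sequence that is
  bounded below.\<close>

lemma quasi_decreasing_convergent:
  fixes a e :: "nat \<Rightarrow> real"
  assumes nonneg: "\<And>k. 0 \<le> a k" "\<And>k. 0 \<le> e k" and "summable e"
    and step: "\<And>k. a (Suc k) \<le> a k + e k"
  shows "convergent a"
proof -
  define b where "b k = a k - (\<Sum>i<k. e i)" for k
  have "decseq b"
    using step by (intro decseq_SucI) (simp add: b_def algebra_simps)
  moreover have "- suminf e \<le> b k" for k
    using sum_le_suminf[OF \<open>summable e\<close>, of "{..<k}"] nonneg(1)[of k] nonneg(2)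
    by (force simp: b_def)
  ultimately obtain l where "b \<longlonglongrightarrow> l"
    using decseq_convergent by blast
  then have "(\<lambda>k. b k + (\<Sum>i<k. e i)) \<longlonglongrightarrow> l + suminf e"
    using summable_LIMSEQ[OF \<open>summable e\<close>] by (rule tendsto_add)
  then show ?thesis
    by (auto simp: b_def convergent_def)
qed

text \<open>\<open>grad\<close> is assumed only on the ball around \<open>x\<close> through
  \<open>z\<close>; it makes the distance to \<open>x\<close> nonincreasing, which keeps the
  iterates in that ball.\<close>

lemma gradient_descent_convex_convergent:
  fixes c :: "'a::euclidean_space \<Rightarrow> real"
  assumes convex: "convex_on UNIV c" and nonneg: "\<And>w. 0 \<le> c w" and "c x = 0"
    and D: "\<And>w. GDERIV c w :> gradient c w"
    and grad: "\<And>w. w \<in> cball x (norm (x - z)) \<Longrightarrow>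
      \<eta> * (norm (gradient c w))\<^sup>2 \<le> inner (w - x) (gradient c w)"
    and "\<eta> > 0"
  shows "norm (x - gradient_descent c \<eta> z K) \<le> norm (x - z)"
    and "convergent (gradient_descent c \<eta> z)"
proof -
  define w where "w = gradient_descent c \<eta> z"
  define G where "G k = gradient c (w k)" for k
  define e where "e k = (\<eta> * norm (G k))\<^sup>2" for k
  have tangent: "c (w k) + inner (v - w k) (G k) \<le> c v" for v k
    unfolding G_def by (rule convex_on_imp_above_tangent_plane[OF convex D])
  \<comment> \<open>The reference point stays free: it is \<open>x\<close> first and a cluster point
    later.\<close>
  have expand: "(norm (w (Suc k) - p))\<^sup>2
      = (norm (w k - p))\<^sup>2 - 2 * \<eta> * inner (w k - p) (G k) + e k" for p k
  proof -
    have "w (Suc k) - p = (w k - p) - \<eta> *\<^sub>R G k"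
      by (simp add: w_def G_def)
    moreover have "(norm (a - \<eta> *\<^sub>R g))\<^sup>2
        = (norm a)\<^sup>2 - 2 * \<eta> * inner a g + (\<eta> * norm g)\<^sup>2" for a g :: 'a
      unfolding power_mult_distrib power2_norm_eq_inner
      by (simp add: inner_diff inner_commute power2_eq_square algebra_simps)
    ultimately show ?thesis
      by (simp only: e_def)
  qed
  have fejer: "norm (w k - x) \<le> norm (x - z) \<and> (norm (w (Suc k) - x))\<^sup>2 + e k \<le> (norm (w k - x))\<^sup>2"
    for k
  proof -
    \<comment> \<open>By \<open>grad\<close>, half of the cross term in \<open>expand\<close>
      cancels \<open>e k\<close>, and the other half provides the decrease.\<close>
    have decr: "(norm (w (Suc k) - x))\<^sup>2 + e k \<le> (norm (w k - x))\<^sup>2"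
      if "norm (w k - x) \<le> norm (x - z)" for k
    proof -
      have "\<eta> * (norm (G k))\<^sup>2 \<le> inner (w k - x) (G k)"
        unfolding G_def using that by (intro grad) (simp add: dist_norm norm_minus_commute)
      then have "\<eta> * (\<eta> * (norm (G k))\<^sup>2) \<le> \<eta> * inner (w k - x) (G k)"
        using \<open>\<eta> > 0\<close> by (intro mult_left_mono) auto
      then have "e k \<le> \<eta> * inner (w k - x) (G k)"
        by (simp add: e_def power2_eq_square mult_ac)
      then show ?thesis
        unfolding expand[of k x] by simp
    qed
    have "norm (w k - x) \<le> norm (x - z)"
    proof (induction k)
      case 0
      then show ?case by (simp add: w_def norm_minus_commute)
    next
      case (Suc k)
      have "0 \<le> e k" by (simp add: e_def)
      then have "(norm (w (Suc k) - x))\<^sup>2 \<le> (norm (w k - x))\<^sup>2"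
        using decr[OF Suc] by linarith
      then have "norm (w (Suc k) - x) \<le> norm (w k - x)"
        by (rule power2_le_imp_le) simp
      then show ?case using Suc by simp
    qed
    with decr show ?thesis by blast
  qed
  show "norm (x - gradient_descent c \<eta> z K) \<le> norm (x - z)"
    using fejer[of K] by (simp add: w_def norm_minus_commute)
  have e_nonneg: "0 \<le> e k" for k
    by (simp add: e_def)
  \<comment> \<open>The decreases telescope.\<close>
  have "(\<Sum>i<k. e i) + (norm (w k - x))\<^sup>2 \<le> (norm (w 0 - x))\<^sup>2" for k
  proof (induction k)
    case (Suc k)
    then show ?case using conjunct2[OF fejer[of k]] by simp
  qed simp
  then have "(\<Sum>i<k. e i) \<le> (norm (w 0 - x))\<^sup>2" for k
    by (smt (verit) zero_le_power2)
  then have "summable e"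
    using e_nonneg by (rule summableI_nonneg_bounded[rotated])
  \<comment> \<open>Here \<open>sqrt (e k) / \<eta>\<close> is \<open>norm (G k)\<close>, so the
    gradients tend to \<open>0\<close>.\<close>
  have "(\<lambda>k. sqrt (e k) / \<eta> * norm (x - z)) \<longlonglongrightarrow> sqrt 0 / \<eta> * norm (x - z)"
    using summable_LIMSEQ_zero[OF \<open>summable e\<close>] \<open>\<eta> > 0\<close> by (intro tendsto_intros) auto
  then have "(\<lambda>k. norm (G k) * norm (x - z)) \<longlonglongrightarrow> 0"
    using \<open>\<eta> > 0\<close> by (simp add: e_def)
  moreover have "c (w k) \<le> norm (G k) * norm (x - z)" for k
  proof -
    have "c (w k) \<le> inner (w k - x) (G k)"
      using tangent[of k x] \<open>c x = 0\<close> by (simp add: inner_diff_left)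
    also have "\<dots> \<le> norm (w k - x) * norm (G k)"
      by (rule norm_cauchy_schwarz)
    also have "\<dots> \<le> norm (x - z) * norm (G k)"
      using fejer[of k] by (intro mult_right_mono) auto
    finally show ?thesis by (simp add: mult.commute)
  qed
  ultimately have cost_lim: "(\<lambda>k. c (w k)) \<longlonglongrightarrow> 0"
    using nonneg by (intro tendsto_sandwich[of "\<lambda>_. 0" "\<lambda>k. c (w k)"]) auto
  have "\<forall>k. w k \<in> cball x (norm (x - z))"
    using fejer by (simp add: dist_norm norm_minus_commute)
  then obtain p r where r: "strict_mono r" "(w \<circ> r) \<longlonglongrightarrow> p"
    using compact_cball[unfolded compact_def] by metis
  have "isCont c p"
    using D[of p] unfolding gderiv_def by (rule has_derivative_continuous)
  then have "(\<lambda>k. c ((w \<circ> r) k)) \<longlonglongrightarrow> c p"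
    using r(2) by (rule isCont_tendsto_compose)
  moreover have "(\<lambda>k. c ((w \<circ> r) k)) \<longlonglongrightarrow> 0"
    using LIMSEQ_subseq_LIMSEQ[OF cost_lim r(1)] by (simp add: comp_def)
  ultimately have "c p = 0"
    by (rule LIMSEQ_unique)
  \<comment> \<open>\<open>grad\<close> concerns \<open>x\<close> alone. For \<open>p\<close>
    convexity gives the sign of the inner product, so \<open>e k\<close> remains as an
    error.\<close>
  have "(norm (w (Suc k) - p))\<^sup>2 \<le> (norm (w k - p))\<^sup>2 + e k" for k
  proof -
    have "0 \<le> inner (w k - p) (G k)"
      using tangent[of k p] nonneg[of "w k"] \<open>c p = 0\<close> by (simp add: inner_diff_left)
    then show ?thesis
      unfolding expand using \<open>\<eta> > 0\<close> by simp
  qed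
  then have "convergent (\<lambda>k. (norm (w k - p))\<^sup>2)"
    using e_nonneg \<open>summable e\<close> by (intro quasi_decreasing_convergent[of _ e]) auto
  then obtain l where l: "(\<lambda>k. (norm (w k - p))\<^sup>2) \<longlonglongrightarrow> l"
    by (auto simp: convergent_def)
  \<comment> \<open>The limit \<open>l\<close> of the whole sequence can be read off along the
    subsequence.\<close>
  have "(\<lambda>k. (norm ((w \<circ> r) k - p))\<^sup>2) \<longlonglongrightarrow> (norm (p - p))\<^sup>2"
    by (intro tendsto_intros r(2))
  then have "l = 0"
    using LIMSEQ_unique[OF LIMSEQ_subseq_LIMSEQ[OF l r(1)]] by (simp add: comp_def)
  then have "(\<lambda>k. sqrt ((norm (w k - p))\<^sup>2)) \<longlonglongrightarrow> sqrt 0"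
    using l by (intro tendsto_intros) auto
  then have "w \<longlonglongrightarrow> p"
    by (simp add: tendsto_norm_zero_iff LIM_zero_iff)
  then show "convergent (gradient_descent c \<eta> z)"
    by (auto simp: convergent_def w_def)
qed

section \<open>Choice of the constants and of the step size\<close>

theorem theorem1:
  fixes x y z :: "real ^ 'n" and f :: "real ^ 'n \<Rightarrow> real" and M :: real
  assumes "\<And>w. f differentiable (at w)"
    and "f x = M"
    and "z = x + y"
    and "convex_on UNIV (cost f M)"
  shows "\<exists>\<Lambda>>0. \<forall>\<eta>. 0 < \<eta> \<and> \<eta> < \<Lambda> \<longrightarrow>
    (\<forall>K. norm (x - gradient_descent (cost f M) \<eta> z K) \<le> norm (x - z)) \<and>
    (\<exists>zlim. gradient_descent (cost f M) \<eta> z \<longlonglongrightarrow> zlim \<and> norm (x - zlim) \<le> norm (x - z))"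
proof -
  define c where "c = cost f M"
  define R where "R = norm (x - z)"
  have convex: "convex_on UNIV c"
    using assms(4) by (simp add: c_def)
  have nonneg: "0 \<le> c w" for w
    by (simp add: c_def cost_def)
  have "c x = 0"
    using assms(2) by (simp add: c_def cost_def)
  have D: "GDERIV c w :> gradient c w" for w
    unfolding c_def cost_def[abs_def]
    by (intro gderiv_gradient differentiable_power differentiable_diff assms(1)
        differentiable_const)
  \<comment> \<open>The extra radius \<open>1\<close> leaves room for the unit step in the gradient
    bound.\<close>
  obtain C0 where C0: "\<And>h. h \<in> cball x (R + 1) \<Longrightarrow> c h \<le> C0 * (norm (h - x))\<^sup>2"
    unfolding c_def by (rule cost_quadratic_bound[OF assms(1,2)]) blast
  \<comment> \<open>\<open>C\<close> also exceeds the bound on \<open>\<nabla>c\<close> below, which keeps the test point in the ball.\<close>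
  define C where "C = max 1 C0 * (R + 1)\<^sup>2"
  have "R \<ge> 0"
    by (simp add: R_def)
  then have R1: "1 \<le> (R + 1)\<^sup>2"
    by simp
  have "max 1 C0 * 1 \<le> C"
    unfolding C_def using R1 by (intro mult_left_mono) auto
  then have C: "1 \<le> C" "C0 \<le> C"
    by auto
  have bound: "c h \<le> C * (norm (h - x))\<^sup>2" if "h \<in> cball x (R + 1)" for h
  proof -
    have "c h \<le> C0 * (norm (h - x))\<^sup>2"
      using that by (rule C0)
    also have "\<dots> \<le> C * (norm (h - x))\<^sup>2"
      using C by (intro mult_right_mono) auto
    finally show ?thesis .
  qed
  \<comment> \<open>On this ball \<open>norm (h - x)\<close> is at most \<open>R + 1\<close>, whence
    the factor \<open>(R + 1)\<^sup>2\<close> in \<open>C\<close>.\<close>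
  have "c h \<le> C" if h: "h \<in> cball x (R + 1)" for h
  proof -
    have "c h \<le> C0 * (norm (h - x))\<^sup>2"
      using h by (rule C0)
    also have "\<dots> \<le> max 1 C0 * (R + 1)\<^sup>2"
      using h by (intro mult_mono power_mono) (auto simp: dist_norm norm_minus_commute)
    finally show ?thesis by (simp add: C_def)
  qed
  then have grad_le: "norm (gradient c w) \<le> C" if "w \<in> cball x R" for w
    using that by (intro gradient_bounded_on_cball[OF convex nonneg D]) auto
  have cocoercive: "(norm (gradient c w))\<^sup>2 \<le> 4 * C * inner (w - x) (gradient c w)"
    if w: "w \<in> cball x R" for w
  proof (rule norm_sq_gradient_le_of_quadratic_bound[OF convex D nonneg])
    \<comment> \<open>The test point lies within \<open>1 / 2\<close> of \<open>x\<close>, hence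
      where \<open>bound\<close> applies.\<close>
    have "norm ((1 / (2 * C)) *\<^sub>R gradient c w) = norm (gradient c w) / (2 * C)"
      using C by simp
    also have "\<dots> \<le> C / (2 * C)"
      using grad_le[OF w] C by (intro divide_right_mono) auto
    also have "\<dots> \<le> R + 1"
      using C \<open>R \<ge> 0\<close> by simp
    finally show "c (x + (1 / (2 * C)) *\<^sub>R gradient c w)
        \<le> C * (norm ((1 / (2 * C)) *\<^sub>R gradient c w))\<^sup>2"
      using bound[of "x + (1 / (2 * C)) *\<^sub>R gradient c w"] by (simp add: dist_norm)
  qed (use C in simp)
  show ?thesis
    unfolding c_def[symmetric]
  proof (intro exI[of _ "1 / (4 * C)"] conjI allI impI)
    show "0 < 1 / (4 * C)"
      using C by simp
  next
    fix \<eta> :: real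
    assume \<eta>: "0 < \<eta> \<and> \<eta> < 1 / (4 * C)"
    have grad: "\<eta> * (norm (gradient c w))\<^sup>2 \<le> inner (w - x) (gradient c w)"
      if "w \<in> cball x (norm (x - z))" for w
    proof -
      have "\<eta> * (norm (gradient c w))\<^sup>2 \<le> 1 / (4 * C) * (norm (gradient c w))\<^sup>2"
        using \<eta> by (intro mult_right_mono) auto
      also have "\<dots> \<le> inner (w - x) (gradient c w)"
        using cocoercive[of w] that C by (simp add: R_def field_simps)
      finally show ?thesis .
    qed
    note descent = gradient_descent_convex_convergent[OF convex nonneg \<open>c x = 0\<close> D grad]
    show dist: "norm (x - gradient_descent c \<eta> z K) \<le> norm (x - z)" for K
      using \<eta> by (intro descent(1)) auto
    obtain p where p: "gradient_descent c \<eta> z \<longlonglongrightarrow> p"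
      using descent(2) \<eta> by (auto simp: convergent_def)
    then have "(\<lambda>K. norm (x - gradient_descent c \<eta> z K)) \<longlonglongrightarrow> norm (x - p)"
      by (intro tendsto_intros)
    then have "norm (x - p) \<le> norm (x - z)"
      using dist by (intro LIMSEQ_le_const2) auto
    with p show "\<exists>zlim. gradient_descent c \<eta> z \<longlonglongrightarrow> zlim \<and> norm (x - zlim) \<le> norm (x - z)"
      by blast
  qed
qed

end
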